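(* Let $n\ge 1$. If $f:\mathbb{R}^n\to[0,\infty)$ is log-concave on $\mathbb{R}^n$, then the function $$G(\alpha):=\alpha^n\int_{\mathbb{R}^n} f(x)^{\alpha}\,dx$$ is log-concave on $(0,+\infty)$.
   Context: A function $f:\mathbb{R}^n\to[0,\infty)$ is log-concave if $f=e^{-U}$ for some convex function $U:\mathbb{R}^n\to(-\infty,+\infty]$ (with $e^{-\infty}=0$). The function $G$ takes values in $[0,+\infty]$, and log-concavity of $G$ on $(0,+\infty)$ means $G(\lambda\alpha_1+(1-\lambda)\alpha_2)\ge G(\alpha_1)^{\lambda}G(\alpha_2)^{1-\lambda}$ for all $\alpha_1,\alpha_2>0$ and $0<\lambda<1$. *)

theory Defs
  imports "HOL-Analysis.Analysis"
begin

(* Convexity of U : V -> (-\<infinity>, +\<infinity>]. The weights are taken in the open interval,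
   so no product 0 * \<infinity> occurs; for t = 0 and t = 1 the inequality is trivial. *)
definition convex_ext :: "('a::real_vector \<Rightarrow> ereal) \<Rightarrow> bool" where
  "convex_ext U \<longleftrightarrow>
     (\<forall>x. U x \<noteq> -\<infinity>) \<and>
     (\<forall>x y t. 0 < t \<longrightarrow> t < 1 \<longrightarrow>
        U (t *\<^sub>R x + (1 - t) *\<^sub>R y) \<le> ereal t * U x + ereal (1 - t) * U y)"

(* exp (-u) for u in (-\<infinity>, +\<infinity>], with exp (-\<infinity>) = 0; the value at u = -\<infinity> is irrelevant. *)
definition exp_minus :: "ereal \<Rightarrow> real" where
  "exp_minus u = (if u = \<infinity> then 0 else exp (- real_of_ereal u))"

definition log_concave :: "('a::real_vector \<Rightarrow> real) \<Rightarrow> bool" where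
  "log_concave f \<longleftrightarrow> (\<exists>U. convex_ext U \<and> (\<forall>x. f x = exp_minus (U x)))"

(* Power a^r of a in [0, +\<infinity>] with a positive real exponent r: 0^r = 0 and \<infinity>^r = \<infinity>.
   Not meaningful for r \<le> 0. *)
definition ennreal_powr :: "ennreal \<Rightarrow> real \<Rightarrow> ennreal" where
  "ennreal_powr a r = (if a = \<infinity> then \<infinity> else ennreal (enn2real a powr r))"

definition log_concave_on_pos :: "(real \<Rightarrow> ennreal) \<Rightarrow> bool" where
  "log_concave_on_pos G \<longleftrightarrow>
     (\<forall>a b t. 0 < a \<longrightarrow> 0 < b \<longrightarrow> 0 < t \<longrightarrow> t < 1 \<longrightarrow>
        G (t * a + (1 - t) * b) \<ge> ennreal_powr (G a) t * ennreal_powr (G b) (1 - t))"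

end

theory Submission
  imports Defs
begin

text \<open>
  The substitution \<open>z = \<alpha> x\<close> absorbs the factor \<open>\<alpha>\<^sup>n\<close>: \<open>G \<alpha>\<close> is the integral of
  \<open>h\<^sub>\<alpha> z = f (z / \<alpha>)\<^sup>\<alpha>\<close>. In terms of \<open>f = exp (- U)\<close> one has
  \<open>h\<^sub>\<alpha> z = exp (- \<alpha> U (z / \<alpha>))\<close>, and the perspective \<open>(\<alpha>, z) \<mapsto> \<alpha> U (z / \<alpha>)\<close> of a convex function
  is jointly convex. Hence \<open>h\<close> is jointly log-concave in \<open>(\<alpha>, z)\<close>, and the log-concavity of its
  marginal \<open>G\<close> is exactly the conclusion of the Prekopa-Leindler inequality for the three functions
  \<open>h\<^sub>a\<close>, \<open>h\<^sub>b\<close> and \<open>h\<^sub>c\<close> with \<open>c = t a + (1 - t) b\<close>.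

  The bulk of the development proves that inequality (\<open>Prekopa_Leindler\<close>) for Lebesgue measurable
  functions with values in \<open>[0, \<infinity>]\<close>. On the line, after both functions have been normalised to have
  supremum 1, each superlevel set of \<open>w\<close> at a height below 1 contains a weighted Minkowski sum
  of nonempty superlevel sets of \<open>u\<close> and \<open>v\<close>. The one-dimensional Brunn-Minkowski inequality
  (\<open>Brunn_Minkowski_real\<close>), integrated over the height, bounds \<open>\<integral>w\<close> below by the weighted arithmetic
  mean of \<open>\<integral>u\<close> and \<open>\<integral>v\<close>, hence by their geometric mean. Fubini propagates the inequality to
  finite products, because integrating out all but one coordinate leaves functions that again
  satisfy the hypothesis on the line.

  Fubini requires Borel functions, whereas a log-concave function need not be Borel: an example
  is the indicator of an open disc together with a non-Borel subset of its boundary circle. It is Lebesgue measurable, since its superlevel sets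
  are convex and the boundary of a convex set is a null set. This suffices, because the
  inequality passes from Borel envelopes (\<open>Borel_envelopes\<close>) to Lebesgue measurable functions.
\<close>

section \<open>Real powers and geometric means in the extended half-line\<close>


lemma ennreal_powr_top [simp]: "ennreal_powr top r = top"
  by (simp add: ennreal_powr_def)

lemma ennreal_powr_ennreal [simp]:
  "0 \<le> x \<Longrightarrow> ennreal_powr (ennreal x) r = ennreal (x powr r)"
  by (simp add: ennreal_powr_def)

lemma ennreal_powr_0 [simp]: "ennreal_powr 0 r = 0"
  by (simp add: ennreal_powr_def)

lemma ennreal_powr_mono:
  assumes "0 < r" "a \<le> b"
  shows "ennreal_powr a r \<le> ennreal_powr b r"
  using assms by (cases a rule: ennreal_cases; cases b rule: ennreal_cases)
    (auto simp: powr_mono2 ennreal_leI top_unique)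

lemma ennreal_powr_powr_inverse:
  assumes "r \<noteq> 0"
  shows "ennreal_powr (ennreal_powr a r) (1 / r) = a"
  using assms by (cases a rule: ennreal_cases) (auto simp: powr_powr)

lemma ennreal_powr_mult:
  assumes "0 < r"
  shows "ennreal_powr (a * b) r = ennreal_powr a r * ennreal_powr b r"
proof (cases "a = top \<or> b = top")
  case True
  have pos: "ennreal_powr c r \<noteq> 0" if "c \<noteq> 0" for c
    using that by (cases c rule: ennreal_cases) auto
  from True show ?thesis
    using pos[of a] pos[of b]
    by (cases "a = 0"; cases "b = 0") (auto simp: ennreal_top_mult ennreal_mult_top)
next
  case False
  then show ?thesis
    by (cases a rule: ennreal_cases; cases b rule: ennreal_cases)
      (auto simp: powr_mult simp flip: ennreal_mult)
qed

lemma ennreal_powr_split: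
  assumes "0 < t" "t < 1"
  shows "ennreal_powr a t * ennreal_powr a (1 - t) = a"
  using assms
  by (cases a rule: ennreal_cases) (auto simp flip: ennreal_mult powr_add)

text \<open>The power \<open>x \<mapsto> x\<^sup>r\<close> is an order isomorphism of \<open>[0, \<infinity>]\<close> whose inverse is the power with
  exponent \<open>1 / r\<close>, so it preserves suprema.\<close>

lemma ennreal_powr_SUP:
  fixes a :: "nat \<Rightarrow> ennreal"
  assumes "0 < r"
  shows "ennreal_powr (SUP k. a k) r = (SUP k. ennreal_powr (a k) r)"
proof (rule antisym)
  let ?S = "SUP k. ennreal_powr (a k) r"
  have "a k \<le> ennreal_powr ?S (1 / r)" for k
  proof -
    have "ennreal_powr (ennreal_powr (a k) r) (1 / r) \<le> ennreal_powr ?S (1 / r)"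
      using assms by (intro ennreal_powr_mono SUP_upper) auto
    then show ?thesis using assms by (simp add: ennreal_powr_powr_inverse)
  qed
  then have "(SUP k. a k) \<le> ennreal_powr ?S (1 / r)"
    by (rule SUP_least)
  then have "ennreal_powr (SUP k. a k) r \<le> ennreal_powr (ennreal_powr ?S (1 / r)) r"
    using assms by (rule ennreal_powr_mono[rotated])
  also have "\<dots> = ?S"
    using ennreal_powr_powr_inverse[of "1 / r" ?S] assms by simp
  finally show "ennreal_powr (SUP k. a k) r \<le> ?S" .
  show "?S \<le> ennreal_powr (SUP k. a k) r"
    using assms by (intro SUP_least ennreal_powr_mono SUP_upper) auto
qed

definition geom_mean :: "real \<Rightarrow> ennreal \<Rightarrow> ennreal \<Rightarrow> ennreal" where
  "geom_mean t a b = ennreal_powr a t * ennreal_powr b (1 - t)"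

lemma geom_mean_mono:
  assumes "0 < t" "t < 1" "a \<le> a'" "b \<le> b'"
  shows "geom_mean t a b \<le> geom_mean t a' b'"
  unfolding geom_mean_def using assms by (intro mult_mono ennreal_powr_mono) auto

lemma geom_mean_0 [simp]: "geom_mean t 0 b = 0" "geom_mean t a 0 = 0"
  by (auto simp: geom_mean_def)

text \<open>A point lying in the superlevel sets of both functions at one height yields
  a geometric mean above that height.\<close>

lemma min_le_geom_mean:
  assumes "0 < t" "t < 1"
  shows "min a b \<le> geom_mean t a b"
proof -
  have "min a b = geom_mean t (min a b) (min a b)"
    using assms by (simp add: geom_mean_def ennreal_powr_split)
  also have "\<dots> \<le> geom_mean t a b"
    using assms by (intro geom_mean_mono) auto
  finally show ?thesis .
qed

lemma geom_mean_le_arith_mean: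
  assumes "0 < t" "t < 1"
  shows "geom_mean t a b \<le> ennreal t * a + ennreal (1 - t) * b"
proof (cases "a = top \<or> b = top")
  case True
  then show ?thesis using assms by (auto simp: ennreal_mult_top)
next
  case False
  then obtain x y where xy: "a = ennreal x" "b = ennreal y" "0 \<le> x" "0 \<le> y"
    by (cases a rule: ennreal_cases; cases b rule: ennreal_cases) auto
  have "x powr t * y powr (1 - t) \<le> t * x + (1 - t) * y"
    using assms xy Youngs_inequality_0[of t "1 - t" x y]
    by (cases "x = 0"; cases "y = 0") auto
  then show ?thesis
    using assms xy
    by (simp add: geom_mean_def ennreal_leI flip: ennreal_mult ennreal_plus)
qed

lemma geom_mean_mult:
  assumes "0 < t" "t < 1"
  shows "geom_mean t (c * a) (d * b) = geom_mean t c d * geom_mean t a b"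
  using assms by (simp add: geom_mean_def ennreal_powr_mult mult_ac)

lemma geom_mean_SUP:
  fixes a b :: "nat \<Rightarrow> ennreal"
  assumes "0 < t" "t < 1"
  shows "geom_mean t (SUP k. a k) (SUP l. b l) = (SUP k. SUP l. geom_mean t (a k) (b l))"
  using assms
  by (simp add: geom_mean_def ennreal_powr_SUP SUP_mult_left_ennreal SUP_mult_right_ennreal)
    (rule SUP_commute)

section \<open>The Brunn-Minkowski inequality on the line\<close>

text \<open>A sequence in \<open>A\<close> that increases to \<open>Sup A\<close> exhausts \<open>A\<close> by initial segments, except possibly
  for the single point \<open>Sup A\<close>. The summand \<open>d\<close> allows a two-set estimate to be extended
  in one of the sets at a time, without subtracting possibly infinite measures.\<close>

lemma emeasure_le_initial_segments:
  fixes A :: "real set"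
  assumes A: "A \<in> sets borel" "A \<noteq> {}"
    and le: "\<And>a. a \<in> A \<Longrightarrow> emeasure lborel (A \<inter> {..a}) + d \<le> c"
  shows "emeasure lborel A + d \<le> c"
proof -
  have "ereal ` A \<noteq> {}" using A by auto
  from Sup_countable_SUP[OF this] obtain f :: "nat \<Rightarrow> ereal"
    where f: "incseq f" "range f \<subseteq> ereal ` A" "Sup (ereal ` A) = (SUP i. f i)" by blast
  then have "\<forall>n. \<exists>a. a \<in> A \<and> f n = ereal a" by auto
  then obtain a where a: "\<And>n. a n \<in> A" "\<And>n. f n = ereal (a n)" by metis
  let ?U = "\<Union>n. A \<inter> {..a n}"
  have inc: "incseq (\<lambda>n. A \<inter> {..a n})"
    using f(1) a(2) unfolding incseq_def by (auto intro: order_trans)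
  have U: "?U \<in> sets lborel" using A by auto
  \<comment> \<open>Whatever the segments miss equals the supremum of \<open>A\<close>, so it is at most one point.\<close>
  have "x = y" if x: "x \<in> A - ?U" and y: "y \<in> A - ?U" for x y
  proof -
    have top: "ereal z = Sup (ereal ` A)" if "z \<in> A - ?U" for z
    proof (rule antisym)
      show "ereal z \<le> Sup (ereal ` A)" using that by (auto intro: Sup_upper)
      have "f n \<le> ereal z" for n
        using that a[of n] by (auto simp: not_le intro: less_imp_le)
      then show "Sup (ereal ` A) \<le> ereal z" unfolding f(3) by (rule SUP_least)
    qed
    show "x = y" using top[OF x] top[OF y] by (metis ereal.inject)
  qed
  then obtain m where "A - ?U \<subseteq> {m}" by (cases "A - ?U = {}") blast+
  then have null: "A - ?U \<in> null_sets lborel"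
    by (meson countable_empty countable_insert countable_subset countable_imp_null_set_lborel)
  have "emeasure lborel A = emeasure lborel (?U \<union> (A - ?U))"
    by (rule arg_cong[where f="emeasure lborel"]) auto
  also have "\<dots> = emeasure lborel ?U"
    using U null by (rule emeasure_Un_null_set)
  also have "\<dots> = (SUP n. emeasure lborel (A \<inter> {..a n}))"
    using A inc by (intro SUP_emeasure_incseq[symmetric]) auto
  finally have "emeasure lborel A + d = (SUP n. emeasure lborel (A \<inter> {..a n}) + d)"
    by (simp add: ennreal_SUP_add_left)
  also have "\<dots> \<le> c" using le a(1) by (intro SUP_least) auto
  finally show ?thesis .
qed

lemma emeasure_lborel_scale:
  fixes A :: "real set"
  assumes [measurable]: "A \<in> sets borel" and c: "c \<noteq> 0"
  shows "emeasure lborel A = ennreal \<bar>c\<bar> * emeasure lborel {x. b + c * x \<in> A}"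
proof -
  have "emeasure lborel A = (\<integral>\<^sup>+x. indicator A x \<partial>lborel)" by simp
  also have "\<dots> = ennreal \<bar>c\<bar> * (\<integral>\<^sup>+x. indicator A (b + c * x) \<partial>lborel)"
    using c by (intro nn_integral_real_affine) auto
  also have "(\<integral>\<^sup>+x. indicator A (b + c * x) \<partial>lborel)
      = (\<integral>\<^sup>+x. indicator {x. b + c * x \<in> A} x \<partial>lborel)"
    by (intro nn_integral_cong) (auto simp: indicator_def)
  also have "\<dots> = emeasure lborel {x. b + c * x \<in> A}"
    by (intro nn_integral_indicator) simp
  finally show ?thesis .
qed

text \<open>For \<open>a \<in> A\<close> and \<open>b \<in> B\<close>, the part of \<open>A\<close> left of \<open>a\<close> translated by \<open>b\<close> and the part of \<open>B\<close> right of \<open>b\<close>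
  translated by \<open>a\<close> both lie in \<open>C\<close> and meet at most in the point \<open>a + b\<close>, so their measures add up.
  Pushing \<open>a\<close> to the right and \<open>b\<close> to the left exhausts both sets.\<close>

lemma Brunn_Minkowski_real:
  fixes A B C :: "real set"
  assumes A [measurable]: "A \<in> sets borel" and B [measurable]: "B \<in> sets borel"
    and C [measurable]: "C \<in> sets borel"
    and ne: "A \<noteq> {}" "B \<noteq> {}"
    and sum: "\<And>x y. x \<in> A \<Longrightarrow> y \<in> B \<Longrightarrow> x + y \<in> C"
  shows "emeasure lborel A + emeasure lborel B \<le> emeasure lborel C"
proof -
  have two: "emeasure lborel (A \<inter> {..a}) + emeasure lborel (B \<inter> {b..}) \<le> emeasure lborel C"
    if ab: "a \<in> A" "b \<in> B" for a b
  proof -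
    let ?P = "{z. - b + 1 * z \<in> A \<inter> {..a}}" and ?Q = "{z. - a + 1 * z \<in> B \<inter> {b..}}"
    have PQ: "?P \<in> sets borel" "?Q \<in> sets borel" by measurable
    have "?P \<inter> ?Q \<subseteq> {a + b}" by auto
    then have null: "?P \<inter> ?Q \<in> null_sets lborel"
      by (meson countable_empty countable_insert countable_subset countable_imp_null_set_lborel)
    have "emeasure lborel (A \<inter> {..a}) + emeasure lborel (B \<inter> {b..})
        = emeasure lborel ?P + emeasure lborel ?Q"
      using emeasure_lborel_scale[of "A \<inter> {..a}" 1 "- b"]
        emeasure_lborel_scale[of "B \<inter> {b..}" 1 "- a"] by simp
    also have "\<dots> = emeasure lborel (?P \<union> ?Q)"
      using PQ null emeasure_Un'[of ?P lborel ?Q] by simp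
    also have "\<dots> \<le> emeasure lborel C"
    proof (rule emeasure_mono)
      show "?P \<union> ?Q \<subseteq> C"
        using sum[of "- b + z" b for z] sum[of a "- a + z" for z] ab by force
    qed simp
    finally show ?thesis .
  qed
  have half: "emeasure lborel A + emeasure lborel (B \<inter> {b..}) \<le> emeasure lborel C"
    if "b \<in> B" for b
    by (rule emeasure_le_initial_segments[OF A ne(1)]) (rule two[OF _ that])
  \<comment> \<open>Final segments of \<open>B\<close> are handled as initial segments of the reflected set.\<close>
  let ?B = "{x. 0 + - 1 * x \<in> B}"
  have "emeasure lborel ?B + emeasure lborel A \<le> emeasure lborel C"
  proof (rule emeasure_le_initial_segments)
    show "?B \<in> sets borel" by measurable
    obtain b where "b \<in> B" using ne by auto
    then show "?B \<noteq> {}" by (auto intro!: exI[of _ "- b"])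
    fix b assume b: "b \<in> ?B"
    have "?B \<inter> {..b} = {x. 0 + - 1 * x \<in> B \<inter> {- b..}}" by auto
    then have "emeasure lborel (?B \<inter> {..b}) = emeasure lborel (B \<inter> {- b..})"
      using emeasure_lborel_scale[of "B \<inter> {- b..}" "- 1" 0] by simp
    then show "emeasure lborel (?B \<inter> {..b}) + emeasure lborel A \<le> emeasure lborel C"
      using half[of "- b"] b by (simp add: add.commute)
  qed
  then show ?thesis
    using emeasure_lborel_scale[of B "- 1" 0] by (simp add: add.commute)
qed


lemma Brunn_Minkowski_real_weighted:
  fixes A B C :: "real set"
  assumes A [measurable]: "A \<in> sets borel" and B [measurable]: "B \<in> sets borel"
    and C [measurable]: "C \<in> sets borel"
    and ne: "A \<noteq> {}" "B \<noteq> {}"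
    and t: "0 < t" "t < 1"
    and sum: "\<And>x y. x \<in> A \<Longrightarrow> y \<in> B \<Longrightarrow> t * x + (1 - t) * y \<in> C"
  shows "ennreal t * emeasure lborel A + ennreal (1 - t) * emeasure lborel B \<le> emeasure lborel C"
proof -
  have scaled: "ennreal c * emeasure lborel D = emeasure lborel {x. 0 + (1 / c) * x \<in> D}"
    if [measurable]: "D \<in> sets borel" and c: "0 < c" for c and D :: "real set"
  proof -
    have "ennreal c * emeasure lborel D
        = (ennreal c * ennreal (1 / c)) * emeasure lborel {x. 0 + (1 / c) * x \<in> D}"
      using emeasure_lborel_scale[of D "1 / c" 0] c by (simp add: mult.assoc)
    also have "ennreal c * ennreal (1 / c) = 1"
      using c by (simp flip: ennreal_mult)
    finally show ?thesis by simp
  qed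
  let ?A = "{x. 0 + (1 / t) * x \<in> A}" and ?B = "{x. 0 + (1 / (1 - t)) * x \<in> B}"
  have "emeasure lborel ?A + emeasure lborel ?B \<le> emeasure lborel C"
  proof (rule Brunn_Minkowski_real)
    obtain a b where "a \<in> A" "b \<in> B" using ne by auto
    then have "t * a \<in> ?A" "(1 - t) * b \<in> ?B" using t by auto
    then show "?A \<noteq> {}" "?B \<noteq> {}" by blast+
    show "x + y \<in> C" if "x \<in> ?A" "y \<in> ?B" for x y
      using sum[of "x / t" "y / (1 - t)"] that t by simp
  qed measurable
  then show ?thesis using t by (simp add: scaled)
qed

section \<open>The Prekopa-Leindler inequality on the line\<close>

text \<open>The layer-cake formula with heights restricted to \<open>(0, 1)\<close>. The restriction is essential later:
  only at these heights are the superlevel sets of functions with supremum 1 known to be nonempty,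
  as Brunn-Minkowski requires.\<close>

lemma nn_integral_min_1_layer_cake:
  fixes u :: "real \<Rightarrow> ennreal"
  assumes [measurable]: "u \<in> borel_measurable borel"
  shows "(\<integral>\<^sup>+x. min 1 (u x) \<partial>lborel)
    = (\<integral>\<^sup>+s. indicator {0<..<1} s * emeasure lborel {x. ennreal s < u x} \<partial>lborel)"
proof -
  have "min 1 (u x) = (\<integral>\<^sup>+s. indicator {0<..<1} s * indicator {x. ennreal s < u x} x \<partial>lborel)" for x
  proof -
    have "(\<integral>\<^sup>+s. indicator {0<..<1} s * indicator {x. ennreal s < u x} x \<partial>lborel)
        = (\<integral>\<^sup>+s. indicator {0<..<enn2real (min 1 (u x))} s \<partial>lborel)"
    proof (rule nn_integral_cong)
      fix s :: real
      show "indicator {0<..<1} s * indicator {x. ennreal s < u x} x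
          = (indicator {0<..<enn2real (min 1 (u x))} s :: ennreal)"
      proof (cases "u x" rule: ennreal_cases)
        case (real r)
        then have "enn2real (min 1 (u x)) = min 1 r"
          by (auto simp: min_def)
        then show ?thesis using real by (auto simp: indicator_def ennreal_less_iff)
      qed (auto simp: indicator_def)
    qed
    also have "\<dots> = min 1 (u x)" by (simp add: min_less_iff_disj)
    finally show ?thesis by simp
  qed
  then have "(\<integral>\<^sup>+x. min 1 (u x) \<partial>lborel)
      = (\<integral>\<^sup>+x. \<integral>\<^sup>+s. indicator {0<..<1} s * indicator {x. ennreal s < u x} x \<partial>lborel \<partial>lborel)"
    by simp
  also have "\<dots> = (\<integral>\<^sup>+s. \<integral>\<^sup>+x. indicator {0<..<1} s * indicator {x. ennreal s < u x} x \<partial>lborel \<partial>lborel)"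
    by (rule lborel_pair.Fubini') measurable
  also have "\<dots> = (\<integral>\<^sup>+s. indicator {0<..<1} s * emeasure lborel {x. ennreal s < u x} \<partial>lborel)"
    by (intro nn_integral_cong) (simp add: nn_integral_cmult)
  finally show ?thesis .
qed

text \<open>The equal suprema make the superlevel sets of \<open>u\<close> and \<open>v\<close> nonempty at the same heights. This is what
  yields the additive bound by the arithmetic mean, which is stronger than the conclusion.\<close>

lemma Prekopa_Leindler_real_normalized:
  fixes u v w :: "real \<Rightarrow> ennreal"
  assumes u [measurable]: "u \<in> borel_measurable borel"
    and v [measurable]: "v \<in> borel_measurable borel"
    and w [measurable]: "w \<in> borel_measurable borel"
    and t: "0 < t" "t < 1"
    and sup: "(SUP x. u x) = 1" "(SUP x. v x) = 1"
    and le: "\<And>x y. geom_mean t (u x) (v y) \<le> w (t * x + (1 - t) * y)"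
  shows "geom_mean t (\<integral>\<^sup>+x. u x \<partial>lborel) (\<integral>\<^sup>+x. v x \<partial>lborel) \<le> (\<integral>\<^sup>+x. w x \<partial>lborel)"
proof -
  let ?L = "\<lambda>g s. indicator {0<..<1} s * emeasure lborel {x. ennreal s < g x}"
  have [measurable]: "?L g \<in> borel_measurable borel"
    if [measurable]: "g \<in> borel_measurable borel" for g :: "real \<Rightarrow> ennreal"
  proof -
    have "(\<lambda>s. \<integral>\<^sup>+x. indicator {x. ennreal s < g x} x \<partial>lborel) \<in> borel_measurable borel"
      by measurable
    then show ?thesis by simp
  qed
  have int: "(\<integral>\<^sup>+x. g x \<partial>lborel) = (\<integral>\<^sup>+s. ?L g s \<partial>lborel)"
    if [measurable]: "g \<in> borel_measurable borel" and g: "(SUP x. g x) = 1"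
    for g :: "real \<Rightarrow> ennreal"
  proof -
    have "g x \<le> 1" for x using g by (metis SUP_upper UNIV_I)
    then show ?thesis
      using nn_integral_min_1_layer_cake[of g] by (simp add: min_absorb2)
  qed
  have level: "ennreal t * ?L u s + ennreal (1 - t) * ?L v s \<le> ?L w s" for s
  proof (cases "s \<in> {0<..<1}")
    case True
    have "ennreal s < (SUP x. u x)" "ennreal s < (SUP x. v x)"
      unfolding sup using True by (simp_all add: ennreal_less_one_iff)
    then have ne: "{x. ennreal s < u x} \<noteq> {}" "{x. ennreal s < v x} \<noteq> {}"
      unfolding less_SUP_iff by auto
    have "ennreal s < w (t * x + (1 - t) * y)" if "ennreal s < u x" "ennreal s < v y" for x y
    proof -
      have "ennreal s < min (u x) (v y)" using that by simp
      also have "\<dots> \<le> w (t * x + (1 - t) * y)"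
        using min_le_geom_mean[OF t] le by (rule order_trans)
      finally show ?thesis .
    qed
    then have "ennreal t * emeasure lborel {x. ennreal s < u x}
        + ennreal (1 - t) * emeasure lborel {x. ennreal s < v x}
        \<le> emeasure lborel {x. ennreal s < w x}"
      by (intro Brunn_Minkowski_real_weighted ne t) auto
    then show ?thesis using True by simp
  qed simp
  have "geom_mean t (\<integral>\<^sup>+x. u x \<partial>lborel) (\<integral>\<^sup>+x. v x \<partial>lborel)
      \<le> ennreal t * (\<integral>\<^sup>+x. u x \<partial>lborel) + ennreal (1 - t) * (\<integral>\<^sup>+x. v x \<partial>lborel)"
    using t by (rule geom_mean_le_arith_mean)
  also have "\<dots> = (\<integral>\<^sup>+s. ennreal t * ?L u s + ennreal (1 - t) * ?L v s \<partial>lborel)"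
    using sup by (simp add: int nn_integral_add nn_integral_cmult)
  also have "\<dots> \<le> (\<integral>\<^sup>+s. ?L w s \<partial>lborel)"
    using level by (rule nn_integral_mono)
  also have "\<dots> = (\<integral>\<^sup>+x. min 1 (w x) \<partial>lborel)"
    by (rule nn_integral_min_1_layer_cake[symmetric]) measurable
  also have "\<dots> \<le> (\<integral>\<^sup>+x. w x \<partial>lborel)"
    by (intro nn_integral_mono) simp
  finally show ?thesis .
qed

text \<open>Both sides of the inequality are homogeneous, so finite nonzero suprema can be scaled to 1.\<close>

lemma Prekopa_Leindler_real_bounded:
  fixes u v w :: "real \<Rightarrow> ennreal"
  assumes u [measurable]: "u \<in> borel_measurable borel"
    and v [measurable]: "v \<in> borel_measurable borel"
    and w [measurable]: "w \<in> borel_measurable borel"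
    and t: "0 < t" "t < 1"
    and fin: "(SUP x. u x) < top" "(SUP x. v x) < top"
    and le: "\<And>x y. geom_mean t (u x) (v y) \<le> w (t * x + (1 - t) * y)"
  shows "geom_mean t (\<integral>\<^sup>+x. u x \<partial>lborel) (\<integral>\<^sup>+x. v x \<partial>lborel) \<le> (\<integral>\<^sup>+x. w x \<partial>lborel)"
proof (cases "(SUP x. u x) = 0 \<or> (SUP x. v x) = 0")
  case True
  then have "(\<forall>x. u x = 0) \<or> (\<forall>x. v x = 0)"
    by (metis SUP_upper UNIV_I le_zero_eq)
  then show ?thesis by auto
next
  case False
  define M N where "M = (SUP x. u x)" and "N = (SUP x. v x)"
  have MN: "M \<noteq> 0" "M \<noteq> top" "N \<noteq> 0" "N \<noteq> top"
    using False fin unfolding M_def N_def by (auto simp only: less_top)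
  define K where "K = geom_mean t M N"
  have inv: "c * inverse c = 1" if "c \<noteq> 0" "c \<noteq> top" for c :: ennreal
    using that by (simp add: ennreal_divide_self less_top flip: divide_ennreal_def)
  have Kinv: "K * geom_mean t (inverse M) (inverse N) = 1"
    unfolding K_def using MN t
    by (simp flip: geom_mean_mult add: inv) (simp add: geom_mean_def ennreal_powr_split)
  have "geom_mean t (\<integral>\<^sup>+x. inverse M * u x \<partial>lborel) (\<integral>\<^sup>+x. inverse N * v x \<partial>lborel)
      \<le> (\<integral>\<^sup>+x. geom_mean t (inverse M) (inverse N) * w x \<partial>lborel)"
  proof (rule Prekopa_Leindler_real_normalized)
    show "(SUP x. inverse M * u x) = 1" "(SUP x. inverse N * v x) = 1"
      using MN inv by (simp_all flip: SUP_mult_left_ennreal M_def N_def add: mult.commute)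
    show "geom_mean t (inverse M * u x) (inverse N * v y)
        \<le> geom_mean t (inverse M) (inverse N) * w (t * x + (1 - t) * y)" for x y
      using t le by (simp add: geom_mean_mult mult_left_mono)
  qed (use t in measurable)
  also have "\<dots> = geom_mean t (inverse M) (inverse N) * (\<integral>\<^sup>+x. w x \<partial>lborel)"
    by (rule nn_integral_cmult) simp
  finally have "geom_mean t (inverse M) (inverse N)
        * geom_mean t (\<integral>\<^sup>+x. u x \<partial>lborel) (\<integral>\<^sup>+x. v x \<partial>lborel)
      \<le> geom_mean t (inverse M) (inverse N) * (\<integral>\<^sup>+x. w x \<partial>lborel)"
    using t by (simp add: nn_integral_cmult geom_mean_mult)
  from mult_left_mono[OF this zero_le, of K] show ?thesis
    by (simp only: mult.assoc[symmetric] Kinv mult_1)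
qed

text \<open>Truncating \<open>u\<close> and \<open>v\<close> preserves the hypothesis with the same \<open>w\<close>, and the truncated integrals increase
  to the full ones.\<close>

lemma Prekopa_Leindler_real:
  fixes u v w :: "real \<Rightarrow> ennreal"
  assumes u [measurable]: "u \<in> borel_measurable borel"
    and v [measurable]: "v \<in> borel_measurable borel"
    and w [measurable]: "w \<in> borel_measurable borel"
    and t: "0 < t" "t < 1"
    and le: "\<And>x y. geom_mean t (u x) (v y) \<le> w (t * x + (1 - t) * y)"
  shows "geom_mean t (\<integral>\<^sup>+x. u x \<partial>lborel) (\<integral>\<^sup>+x. v x \<partial>lborel) \<le> (\<integral>\<^sup>+x. w x \<partial>lborel)"
proof -
  have trunc: "(\<integral>\<^sup>+x. g x \<partial>lborel) = (SUP k. \<integral>\<^sup>+x. min (g x) (of_nat k) \<partial>lborel)"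
    if [measurable]: "g \<in> borel_measurable borel" for g :: "real \<Rightarrow> ennreal"
  proof -
    have "(SUP k. min (g x) (of_nat k)) = g x" for x
      by (simp add: inf_min[symmetric] inf_SUP[symmetric] ennreal_SUP_of_nat_eq_top)
    then have "(\<integral>\<^sup>+x. g x \<partial>lborel) = (\<integral>\<^sup>+x. (SUP k. min (g x) (of_nat k)) \<partial>lborel)"
      by simp
    also have "\<dots> = (SUP k. \<integral>\<^sup>+x. min (g x) (of_nat k) \<partial>lborel)"
      by (intro nn_integral_monotone_convergence_SUP)
        (auto simp: incseq_def le_fun_def intro!: min.coboundedI2)
    finally show ?thesis .
  qed
  have "geom_mean t (\<integral>\<^sup>+x. min (u x) (of_nat k) \<partial>lborel) (\<integral>\<^sup>+x. min (v x) (of_nat l) \<partial>lborel)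
      \<le> (\<integral>\<^sup>+x. w x \<partial>lborel)" for k l
  proof (rule Prekopa_Leindler_real_bounded)
    have "(SUP x. min (g x) (of_nat m)) \<le> of_nat m" for m and g :: "real \<Rightarrow> ennreal"
      by (intro SUP_least) simp
    moreover have "of_nat m < (top :: ennreal)" for m
      by (simp add: ennreal_of_nat_eq_real_of_nat)
    ultimately show "(SUP x. min (u x) (of_nat k)) < top" "(SUP x. min (v x) (of_nat l)) < top"
      by (rule le_less_trans)+
    show "geom_mean t (min (u x) (of_nat k)) (min (v y) (of_nat l)) \<le> w (t * x + (1 - t) * y)"
      for x y
      using t by (intro order_trans[OF geom_mean_mono le]) auto
  qed (use t in measurable)
  then show ?thesis
    by (simp add: trunc[OF u] trunc[OF v] geom_mean_SUP[OF t] SUP_le_iff)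
qed


section \<open>The Prekopa-Leindler inequality in several dimensions\<close>

text \<open>Fixing the new coordinate at \<open>r\<close> in \<open>u\<close>, at \<open>s\<close> in \<open>v\<close> and at \<open>t r + (1 - t) s\<close> in \<open>w\<close> gives slices to
  which the induction hypothesis applies. Its conclusion says that the integrals of the slices, as
  functions of the new coordinate, satisfy the hypothesis of the inequality on the line.\<close>

lemma Prekopa_Leindler_PiM:
  fixes u v w :: "('i \<Rightarrow> real) \<Rightarrow> ennreal"
  assumes "finite I" and t: "0 < t" "t < 1"
    and "u \<in> borel_measurable (Pi\<^sub>M I (\<lambda>_. lborel))"
    and "v \<in> borel_measurable (Pi\<^sub>M I (\<lambda>_. lborel))"
    and "w \<in> borel_measurable (Pi\<^sub>M I (\<lambda>_. lborel))"
    and "\<And>x y. x \<in> extensional I \<Longrightarrow> y \<in> extensional I \<Longrightarrow>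
      geom_mean t (u x) (v y) \<le> w (\<lambda>i\<in>I. t * x i + (1 - t) * y i)"
  shows "geom_mean t (\<integral>\<^sup>+x. u x \<partial>Pi\<^sub>M I (\<lambda>_. lborel)) (\<integral>\<^sup>+x. v x \<partial>Pi\<^sub>M I (\<lambda>_. lborel))
    \<le> (\<integral>\<^sup>+x. w x \<partial>Pi\<^sub>M I (\<lambda>_. lborel))"
  using assms(1,4-)
proof (induction I arbitrary: u v w rule: finite_induct)
  case empty
  then show ?case 
    using empty.prems(4)[of "\<lambda>_. undefined" "\<lambda>_. undefined"]
    by (simp add: PiM_empty nn_integral_count_space_finite restrict_def)
next
  case (insert i I)
  interpret product_sigma_finite "\<lambda>_::'i. lborel :: real measure" ..
  note [measurable] = insert.prems(1-3)
  let ?P = "Pi\<^sub>M I (\<lambda>_. lborel :: real measure)"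
  have Fubini: "(\<integral>\<^sup>+x. g x \<partial>Pi\<^sub>M (insert i I) (\<lambda>_. lborel)) = (\<integral>\<^sup>+s. \<integral>\<^sup>+x. g (x(i := s)) \<partial>?P \<partial>lborel)"
    if "g \<in> borel_measurable (Pi\<^sub>M (insert i I) (\<lambda>_. lborel))" for g :: "('i \<Rightarrow> real) \<Rightarrow> ennreal"
    using insert.hyps that by (rule product_nn_integral_insert_rev)
  have slice: "geom_mean t (\<integral>\<^sup>+x. u (x(i := r)) \<partial>?P) (\<integral>\<^sup>+x. v (x(i := s)) \<partial>?P)
      \<le> (\<integral>\<^sup>+x. w (x(i := t * r + (1 - t) * s)) \<partial>?P)" for r s
  proof (rule insert.IH)
    fix x y :: "'i \<Rightarrow> real"
    assume xy: "x \<in> extensional I" "y \<in> extensional I"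
    have "geom_mean t (u (x(i := r))) (v (y(i := s)))
        \<le> w (\<lambda>j\<in>insert i I. t * (x(i := r)) j + (1 - t) * (y(i := s)) j)"
      using xy by (intro insert.prems(4)) (auto simp: extensional_def)
    also have "(\<lambda>j\<in>insert i I. t * (x(i := r)) j + (1 - t) * (y(i := s)) j)
        = (\<lambda>j\<in>I. t * x j + (1 - t) * y j)(i := t * r + (1 - t) * s)"
      using insert.hyps by (auto simp: fun_eq_iff)
    finally show "geom_mean t (u (x(i := r))) (v (y(i := s)))
        \<le> w ((\<lambda>j\<in>I. t * x j + (1 - t) * y j)(i := t * r + (1 - t) * s))" .
  qed measurable
  have "geom_mean t (\<integral>\<^sup>+r. \<integral>\<^sup>+x. u (x(i := r)) \<partial>?P \<partial>lborel) (\<integral>\<^sup>+s. \<integral>\<^sup>+x. v (x(i := s)) \<partial>?P \<partial>lborel)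
      \<le> (\<integral>\<^sup>+s. \<integral>\<^sup>+x. w (x(i := s)) \<partial>?P \<partial>lborel)"
  proof (rule Prekopa_Leindler_real[OF _ _ _ t])
    have "(\<lambda>s. \<integral>\<^sup>+x. g (x(i := s)) \<partial>?P) \<in> borel_measurable borel"
      if [measurable]: "g \<in> borel_measurable (Pi\<^sub>M (insert i I) (\<lambda>_. lborel))"
      for g :: "('i \<Rightarrow> real) \<Rightarrow> ennreal"
    proof -
      interpret finite_product_sigma_finite "\<lambda>_::'i. lborel :: real measure" I
        by standard (rule insert.hyps)
      have "(\<lambda>s. \<integral>\<^sup>+x. g (x(i := s)) \<partial>?P) \<in> borel_measurable lborel"
        by measurable
      then show ?thesis by simp
    qed
    from this[OF insert.prems(1)] this[OF insert.prems(2)] this[OF insert.prems(3)]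
    show "(\<lambda>r. \<integral>\<^sup>+x. u (x(i := r)) \<partial>?P) \<in> borel_measurable borel"
      "(\<lambda>s. \<integral>\<^sup>+x. v (x(i := s)) \<partial>?P) \<in> borel_measurable borel"
      "(\<lambda>s. \<integral>\<^sup>+x. w (x(i := s)) \<partial>?P) \<in> borel_measurable borel" .
  qed (rule slice)
  then show ?case
    unfolding Fubini[OF insert.prems(1)] Fubini[OF insert.prems(2)] Fubini[OF insert.prems(3)] .
qed

lemma Prekopa_Leindler_lborel:
  fixes u v w :: "'a::euclidean_space \<Rightarrow> ennreal"
  assumes u [measurable]: "u \<in> borel_measurable borel"
    and v [measurable]: "v \<in> borel_measurable borel"
    and w [measurable]: "w \<in> borel_measurable borel"
    and t: "0 < t" "t < 1"
    and le: "\<And>x y. geom_mean t (u x) (v y) \<le> w (t *\<^sub>R x + (1 - t) *\<^sub>R y)"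
  shows "geom_mean t (\<integral>\<^sup>+x. u x \<partial>lborel) (\<integral>\<^sup>+x. v x \<partial>lborel) \<le> (\<integral>\<^sup>+x. w x \<partial>lborel)"
proof -
  let ?e = "\<lambda>f :: 'a \<Rightarrow> real. \<Sum>b\<in>Basis. f b *\<^sub>R b"
  let ?P = "Pi\<^sub>M (Basis :: 'a set) (\<lambda>_. lborel :: real measure)"
  have e [measurable]: "?e \<in> borel_measurable ?P" by measurable
  have coords: "(\<integral>\<^sup>+x. g x \<partial>lborel) = (\<integral>\<^sup>+f. g (?e f) \<partial>?P)"
    if [measurable]: "g \<in> borel_measurable borel" for g :: "'a \<Rightarrow> ennreal"
    by (subst lborel_eq) (simp add: nn_integral_distr)
  have "geom_mean t (\<integral>\<^sup>+f. u (?e f) \<partial>?P) (\<integral>\<^sup>+f. v (?e f) \<partial>?P) \<le> (\<integral>\<^sup>+f. w (?e f) \<partial>?P)"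
  proof (rule Prekopa_Leindler_PiM[OF finite_Basis t])
    fix x y :: "'a \<Rightarrow> real"
    have "?e (\<lambda>b\<in>Basis. t * x b + (1 - t) * y b) = t *\<^sub>R ?e x + (1 - t) *\<^sub>R ?e y"
      by (simp add: scaleR_sum_right sum.distrib[symmetric] scaleR_add_left)
    then show "geom_mean t (u (?e x)) (v (?e y)) \<le> w (?e (\<lambda>b\<in>Basis. t * x b + (1 - t) * y b))"
      using le[of "?e x" "?e y"] by simp
  qed measurable
  then show ?thesis by (simp add: coords)
qed

text \<open>A Lebesgue measurable function agrees with a Borel function off a Borel null set; resetting the latter
  to \<open>0\<close> or to \<open>\<infinity>\<close> on that set makes it a lower or an upper bound everywhere.\<close>

lemma Borel_envelopes:
  fixes g :: "'a::euclidean_space \<Rightarrow> ennreal"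
  assumes "g \<in> borel_measurable lebesgue"
  obtains l h where "l \<in> borel_measurable borel" "h \<in> borel_measurable borel"
    "\<And>x. l x \<le> g x" "\<And>x. g x \<le> h x"
    "(\<integral>\<^sup>+x. l x \<partial>lborel) = (\<integral>\<^sup>+x. g x \<partial>lebesgue)"
    "(\<integral>\<^sup>+x. h x \<partial>lborel) = (\<integral>\<^sup>+x. g x \<partial>lebesgue)"
proof -
  obtain g' where g' [measurable]: "g' \<in> borel_measurable borel" and ae: "AE x in lborel. g x = g' x"
    using completion_ex_borel_measurable[OF assms] by auto
  from ae obtain N where N: "N \<in> null_sets lborel" "{x. g x \<noteq> g' x} \<subseteq> N"
    unfolding eventually_ae_filter by fastforce
  have [measurable]: "N \<in> sets borel" using N(1) by auto
  define l where "l x = (if x \<in> N then 0 else g' x)" for x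
  define h where "h x = (if x \<in> N then top else g' x)" for x
  have aeN: "AE x in lborel. x \<notin> N" using N(1) by (rule AE_not_in)
  show ?thesis
  proof (rule that[of l h])
    have "g x = g' x" if "x \<notin> N" for x using N(2) that by auto
    then show "l x \<le> g x" "g x \<le> h x" for x
      by (simp_all add: l_def h_def)
    have "(\<integral>\<^sup>+x. l x \<partial>lborel) = (\<integral>\<^sup>+x. g x \<partial>lborel)" "(\<integral>\<^sup>+x. h x \<partial>lborel) = (\<integral>\<^sup>+x. g x \<partial>lborel)"
      using aeN ae by (auto intro!: nn_integral_cong_AE simp: l_def h_def)
    then show "(\<integral>\<^sup>+x. l x \<partial>lborel) = (\<integral>\<^sup>+x. g x \<partial>lebesgue)"
      "(\<integral>\<^sup>+x. h x \<partial>lborel) = (\<integral>\<^sup>+x. g x \<partial>lebesgue)"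
      by (simp_all add: nn_integral_completion)
    show "l \<in> borel_measurable borel" "h \<in> borel_measurable borel"
      unfolding l_def h_def by measurable
  qed
qed

text \<open>The hypothesis survives lowering \<open>u\<close> and \<open>v\<close> and raising \<open>w\<close>. Lower envelopes of \<open>u\<close> and \<open>v\<close> and
  an upper envelope of \<open>w\<close> therefore reduce the claim to Borel functions, without
  changing any of the three integrals.\<close>

theorem Prekopa_Leindler:
  fixes u v w :: "'a::euclidean_space \<Rightarrow> ennreal"
  assumes u: "u \<in> borel_measurable lebesgue"
    and v: "v \<in> borel_measurable lebesgue"
    and w: "w \<in> borel_measurable lebesgue"
    and t: "0 < t" "t < 1"
    and le: "\<And>x y. geom_mean t (u x) (v y) \<le> w (t *\<^sub>R x + (1 - t) *\<^sub>R y)"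
  shows "geom_mean t (\<integral>\<^sup>+x. u x \<partial>lebesgue) (\<integral>\<^sup>+x. v x \<partial>lebesgue) \<le> (\<integral>\<^sup>+x. w x \<partial>lebesgue)"
proof -
  obtain u' where u': "u' \<in> borel_measurable borel" "\<And>x. u' x \<le> u x"
    "(\<integral>\<^sup>+x. u' x \<partial>lborel) = (\<integral>\<^sup>+x. u x \<partial>lebesgue)" using Borel_envelopes[OF u] by metis
  obtain v' where v': "v' \<in> borel_measurable borel" "\<And>x. v' x \<le> v x"
    "(\<integral>\<^sup>+x. v' x \<partial>lborel) = (\<integral>\<^sup>+x. v x \<partial>lebesgue)" using Borel_envelopes[OF v] by metis
  obtain w' where w': "w' \<in> borel_measurable borel" "\<And>x. w x \<le> w' x"
    "(\<integral>\<^sup>+x. w' x \<partial>lborel) = (\<integral>\<^sup>+x. w x \<partial>lebesgue)" using Borel_envelopes[OF w] by metis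
  have "geom_mean t (u' x) (v' y) \<le> w' (t *\<^sub>R x + (1 - t) *\<^sub>R y)" for x y
    using geom_mean_mono[OF t u'(2) v'(2)] le w'(2) by (meson order_trans)
  from Prekopa_Leindler_lborel[OF u'(1) v'(1) w'(1) t this] show ?thesis
    by (simp add: u' v' w')
qed

section \<open>Measurability and scaling\<close>

text \<open>A convex set differs from its interior by a subset of its frontier, which is a null set.\<close>

lemma convex_sets_lebesgue:
  fixes S :: "'a::euclidean_space set"
  assumes "convex S"
  shows "S \<in> sets lebesgue"
proof -
  have "S = interior S \<union> (S \<inter> frontier S)"
    using interior_subset closure_subset by (auto simp: frontier_def)
  moreover have "S \<inter> frontier S \<in> sets lebesgue"
    using negligible_convex_frontier[OF assms]
    by (metis Int_lower2 negligible_imp_sets negligible_subset)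
  moreover have "interior S \<in> sets lebesgue" by simp
  ultimately show ?thesis by (metis sets.Un)
qed

lemma nn_integral_lebesgue_scale:
  fixes g :: "'a::euclidean_space \<Rightarrow> ennreal"
  assumes g [measurable]: "g \<in> borel_measurable lebesgue" and c: "c \<noteq> 0"
  shows "(\<integral>\<^sup>+x. g x \<partial>lebesgue) = ennreal (\<bar>c\<bar> ^ DIM('a)) * (\<integral>\<^sup>+x. g (c *\<^sub>R x) \<partial>lebesgue)"
proof -
  have T: "(\<lambda>x::'a. 0 + (\<Sum>j\<in>Basis. (c * (x \<bullet> j)) *\<^sub>R j)) = (\<lambda>x. c *\<^sub>R x)"
    by (simp add: fun_eq_iff euclidean_representation flip: scaleR_scaleR scaleR_sum_right)
  have "lebesgue = density (distr lebesgue lebesgue (\<lambda>x::'a. c *\<^sub>R x)) (\<lambda>_. ennreal (\<bar>c\<bar> ^ DIM('a)))"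
    using lebesgue_affine_euclidean[of "\<lambda>_. c" "0::'a"] c unfolding T by simp
  then have "(\<integral>\<^sup>+x. g x \<partial>lebesgue) = (\<integral>\<^sup>+x. g x
      \<partial>density (distr lebesgue lebesgue (\<lambda>x::'a. c *\<^sub>R x)) (\<lambda>_. ennreal (\<bar>c\<bar> ^ DIM('a))))"
    by simp
  also have "\<dots> = ennreal (\<bar>c\<bar> ^ DIM('a)) * (\<integral>\<^sup>+x. g x \<partial>distr lebesgue lebesgue (\<lambda>x::'a. c *\<^sub>R x))"
    using g by (subst nn_integral_density) (auto intro!: nn_integral_cmult)
  also have "\<dots> = ennreal (\<bar>c\<bar> ^ DIM('a)) * (\<integral>\<^sup>+x. g (c *\<^sub>R x) \<partial>lebesgue)"
    by (subst nn_integral_distr) auto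
  finally show ?thesis .
qed

section \<open>Log-concave functions\<close>

lemma log_concave_ineq:
  fixes f :: "'a::real_vector \<Rightarrow> real"
  assumes "log_concave f" "0 < s" "s < 1"
  shows "f x powr s * f y powr (1 - s) \<le> f (s *\<^sub>R x + (1 - s) *\<^sub>R y)"
proof -
  from assms(1) obtain U where U: "convex_ext U" and f: "\<And>x. f x = exp_minus (U x)"
    unfolding log_concave_def by blast
  let ?z = "s *\<^sub>R x + (1 - s) *\<^sub>R y"
  have fin: "U p \<noteq> - \<infinity>" for p using U by (simp add: convex_ext_def)
  have conv: "U ?z \<le> ereal s * U x + ereal (1 - s) * U y"
    using U assms by (simp add: convex_ext_def)
  show ?thesis
  proof (cases "U x = \<infinity> \<or> U y = \<infinity>")
    case True
    then show ?thesis using assms by (auto simp: f exp_minus_def)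
  next
    case False
    then obtain a b where ab: "U x = ereal a" "U y = ereal b"
      using fin by (metis ereal_cases)
    with conv fin[of ?z] obtain c where c: "U ?z = ereal c" "c \<le> s * a + (1 - s) * b"
      by (cases "U ?z") auto
    then show ?thesis
      using ab by (simp add: f exp_minus_def exp_powr_real mult_exp_exp algebra_simps)
  qed
qed

text \<open>The superlevel sets are convex.\<close>

lemma log_concave_measurable_lebesgue:
  fixes f :: "'a::euclidean_space \<Rightarrow> real"
  assumes f: "log_concave f"
  shows "f \<in> borel_measurable lebesgue"
proof -
  have nonneg: "0 \<le> f x" for x
    using f by (auto simp: log_concave_def exp_minus_def)
  have "convex {x. c < f x}" for c
  proof (cases "0 \<le> c")
    case True
    have "c < f (s *\<^sub>R x + (1 - s) *\<^sub>R y)"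
      if xy: "c < f x" "c < f y" and s: "0 < s" "s < 1" for x y s
    proof -
      let ?m = "min (f x) (f y)"
      have m: "0 < ?m" "c < ?m" using xy True by auto
      then have "c < ?m powr s * ?m powr (1 - s)" by (simp flip: powr_add)
      also have "\<dots> \<le> f x powr s * f y powr (1 - s)"
        using m s by (intro mult_mono powr_mono2) auto
      also have "\<dots> \<le> f (s *\<^sub>R x + (1 - s) *\<^sub>R y)"
        using f s by (rule log_concave_ineq)
      finally show ?thesis .
    qed
    note between = this
    show ?thesis
      unfolding convex_alt
    proof safe
      fix x y and r :: real
      assume xy: "c < f x" "c < f y" and "0 \<le> r" "r \<le> 1"
      then consider "r = 0" | "r = 1" | "0 < r" "r < 1" by linarith
      then show "c < f ((1 - r) *\<^sub>R x + r *\<^sub>R y)"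
        using xy between[of x y "1 - r"] by cases auto
    qed
  next
    case False
    then have "{x. c < f x} = UNIV" by (auto intro: less_le_trans[OF _ nonneg])
    then show ?thesis by simp
  qed
  then show ?thesis
    by (auto intro!: borel_measurableI_greater convex_sets_lebesgue)
qed

theorem theorem2p9:
  fixes f :: "real ^ 'n \<Rightarrow> real"
  assumes "\<And>x. f x \<ge> 0"
    and "log_concave f"
  shows "log_concave_on_pos
    (\<lambda>\<alpha>. ennreal (\<alpha> ^ CARD('n)) * (\<integral>\<^sup>+ x. ennreal (f x powr \<alpha>) \<partial>lebesgue))"
proof -
  define h where "h \<alpha> z = ennreal (f ((1 / \<alpha>) *\<^sub>R z) powr \<alpha>)" for \<alpha> z
  note [measurable] = log_concave_measurable_lebesgue[OF assms(2)]
  have h_meas: "h \<alpha> \<in> borel_measurable lebesgue" for \<alpha>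
    unfolding h_def by measurable
  have G: "ennreal (\<alpha> ^ CARD('n)) * (\<integral>\<^sup>+ x. ennreal (f x powr \<alpha>) \<partial>lebesgue) = (\<integral>\<^sup>+ z. h \<alpha> z \<partial>lebesgue)"
    if "0 < \<alpha>" for \<alpha>
    using nn_integral_lebesgue_scale[OF h_meas, of \<alpha> \<alpha>] that by (simp add: h_def)
  have "geom_mean t (\<integral>\<^sup>+ z. h a z \<partial>lebesgue) (\<integral>\<^sup>+ z. h b z \<partial>lebesgue)
      \<le> (\<integral>\<^sup>+ z. h (t * a + (1 - t) * b) z \<partial>lebesgue)"
    if ab: "0 < a" "0 < b" and t: "0 < t" "t < 1" for a b t
  proof (rule Prekopa_Leindler[OF h_meas h_meas h_meas t])
    fix x y :: "real ^ 'n"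
    \<comment> \<open>The weights of the perspective: \<open>(t x + (1 - t) y) / c\<close> is the convex combination of \<open>x / a\<close> and
        \<open>y / b\<close> with weights \<open>s = t a / c\<close> and \<open>1 - s = (1 - t) b / c\<close>, and \<open>s c = t a\<close> matches the powers.\<close>
    define c where "c = t * a + (1 - t) * b"
    define s where "s = t * a / c"
    have c: "0 < c" using ab t by (auto simp: c_def intro!: add_pos_pos)
    have s': "1 - s = (1 - t) * b / c"
      using c by (simp add: s_def c_def field_simps)
    have "0 < s" "0 < 1 - s"
      unfolding s' using ab t c by (simp_all add: s_def)
    then have s: "0 < s" "s < 1" by simp_all
    let ?X = "(1 / a) *\<^sub>R x" and ?Y = "(1 / b) *\<^sub>R y"
    have pt: "s *\<^sub>R ?X + (1 - s) *\<^sub>R ?Y = (1 / c) *\<^sub>R (t *\<^sub>R x + (1 - t) *\<^sub>R y)"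
      unfolding s' using ab by (simp add: s_def scaleR_add_right)
    have "(f ?X powr a) powr t * (f ?Y powr b) powr (1 - t)
        = (f ?X powr s * f ?Y powr (1 - s)) powr c"
      unfolding s' using c by (simp add: s_def powr_mult powr_powr mult_ac)
    also have "\<dots> \<le> f ((1 / c) *\<^sub>R (t *\<^sub>R x + (1 - t) *\<^sub>R y)) powr c"
      using log_concave_ineq[OF assms(2) s, of ?X ?Y] c unfolding pt by (intro powr_mono2) auto
    finally show "geom_mean t (h a x) (h b y) \<le> h (t * a + (1 - t) * b) (t *\<^sub>R x + (1 - t) *\<^sub>R y)"
      by (simp add: geom_mean_def h_def c_def ennreal_leI flip: ennreal_mult)
  qed
  then show ?thesis
    unfolding log_concave_on_pos_def geom_mean_def
    by (simp add: G add_pos_pos)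
qed

end
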